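(* Let $\boldsymbol{P}$ be the preference matrix of a PPICOD problem with $m$ messages over $\mathbb{F}_q$ and $n$ receivers. If the code length--satisfaction pair $(\ell,s)$ is achievable, then $(\ell',s)$ is achievable for every integer $\ell'>\ell$.
   Context: Preferential pliable index coding (PPICOD). A sender has $m\ge 1$ messages $X_{[1:m]}=(X_1,\dots,X_m)$, each taking values in a finite field $\mathbb{F}_q$ of size $q$, where $[a:b]=\{a,a+1,\dots,b\}$ and $X_S=(X_i:i\in S)$. There are $n\ge 1$ receivers; receiver $i\in[1:n]$ already knows $X_{H_i}$ for some $H_i\subsetneq[1:m]$. The problem is described by an $n\times m$ preference matrix $\boldsymbol{P}=[P_{i,j}]$ with entries in $\mathbb{R}\cup\{\infty\}$, where $P_{i,j}$ is the preference rank receiver $i$ gives to $X_j$ (lower is better); $P_{i,j}$ is finite if $j\in[1:m]\setminus H_i$ and $P_{i,j}=\infty$ if $j\in H_i$. A (linear) code of length $\ell$ consists of: an encoding function $\mathsf{E}:\mathbb{F}_q^m\to\mathbb{F}_q^\ell$ of the form $\mathsf{E}(X_{[1:m]})=\boldsymbol{A}\boldsymbol{X}$ with $\boldsymbol{A}\in\mathbb{F}_q^{\ell\times m}$ and $\boldsymbol{X}=[X_1\;\cdots\;X_m]^{\mathrm T}$; a decoding choice $D:[1:n]\to[1:m]$; and for each $i\in[1:n]$ a decoding function $\mathsf{G}_i:\mathbb{F}_q^\ell\times\mathbb{F}_q^{|H_i|}\to\mathbb{F}_q$; such that $D(i)\in[1:m]\setminus H_i$ and $\mathsf{G}_i(\mathsf{E}(X_{[1:m]}),X_{H_i})=X_{D(i)}$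 for all $i\in[1:n]$ and all $X_{[1:m]}\in\mathbb{F}_q^m$. Only linear encoding functions are considered. The overall satisfaction metric of the code is $s=\sum_{i=1}^n P_{i,D(i)}$. A pair $(\ell,s)$ is achievable if there is a code with code length $\ell$ and overall satisfaction metric $s$. *)

theory Defs
  imports "Jordan_Normal_Form.Matrix" "HOL-Library.Extended_Real"
begin

text \<open>
  The finite field is a type \<open>'a\<close> of class \<open>{field, finite}\<close>; its size is \<open>CARD('a)\<close>.
  Messages, receivers and vector components are indexed from 0, following the matrix library:
  \<open>{0..<m}\<close> and \<open>{0..<n}\<close> stand for \<open>[1:m]\<close> and \<open>[1:n]\<close>.
\<close>

text \<open>
  The side information sets \<open>H\<close> and the preference matrix \<open>P\<close>. The type \<open>ereal\<close> also has
  \<open>-\<infinity>\<close>, which the two conditions on the entries exclude.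
\<close>
definition ppicod_problem :: "nat \<Rightarrow> nat \<Rightarrow> (nat \<Rightarrow> nat set) \<Rightarrow> ereal mat \<Rightarrow> bool" where
  "ppicod_problem m n H P \<longleftrightarrow>
     m \<ge> 1 \<and> n \<ge> 1 \<and> (\<forall>i<n. H i \<subset> {0..<m}) \<and> P \<in> carrier_mat n m \<and>
     (\<forall>i<n. \<forall>j\<in>{0..<m} - H i. \<bar>P $$ (i, j)\<bar> \<noteq> \<infinity>) \<and>
     (\<forall>i<n. \<forall>j\<in>H i. P $$ (i, j) = \<infinity>)"

text \<open>\<open>X\<^sub>S = (X\<^sub>i : i \<in> S)\<close> as a vector of dimension \<open>card S\<close>, in increasing order of the index.\<close>
definition subvec :: "'a vec \<Rightarrow> nat set \<Rightarrow> 'a vec" where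
  "subvec X S = vec_of_list (map (\<lambda>i. X $ i) (sorted_list_of_set S))"

definition linear_encoder :: "nat \<Rightarrow> nat \<Rightarrow> ('a::{field,finite} vec \<Rightarrow> 'a vec) \<Rightarrow> bool" where
  "linear_encoder m l E \<longleftrightarrow> (\<exists>A \<in> carrier_mat l m. \<forall>X \<in> carrier_vec m. E X = A *\<^sub>v X)"

text \<open>
  Only the values of \<open>G i\<close> on \<open>carrier_vec l \<times> carrier_vec (card (H i))\<close> matter.
\<close>
definition ppicod_code ::
  "nat \<Rightarrow> nat \<Rightarrow> (nat \<Rightarrow> nat set) \<Rightarrow> nat \<Rightarrow> ('a::{field,finite} vec \<Rightarrow> 'a vec) \<Rightarrow>
   (nat \<Rightarrow> nat) \<Rightarrow> (nat \<Rightarrow> 'a vec \<times> 'a vec \<Rightarrow> 'a) \<Rightarrow> bool" where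
  "ppicod_code m n H l E D G \<longleftrightarrow>
     linear_encoder m l E \<and>
     (\<forall>i<n. D i \<in> {0..<m} - H i) \<and>
     (\<forall>i<n. \<forall>X \<in> carrier_vec m. G i (E X, subvec X (H i)) = X $ D i)"

definition satisfaction :: "nat \<Rightarrow> ereal mat \<Rightarrow> (nat \<Rightarrow> nat) \<Rightarrow> ereal" where
  "satisfaction n P D = (\<Sum>i<n. P $$ (i, D i))"

definition achievable ::
  "'a::{field,finite} itself \<Rightarrow> nat \<Rightarrow> nat \<Rightarrow> (nat \<Rightarrow> nat set) \<Rightarrow> ereal mat \<Rightarrow>
   nat \<times> ereal \<Rightarrow> bool" where
  "achievable TYPE('a) m n H P = (\<lambda>(l, s).
     \<exists>(E :: 'a vec \<Rightarrow> 'a vec) D G.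
       ppicod_code m n H l E D G \<and> satisfaction n P D = s)"

end

theory Submission imports Defs begin

text \<open>A longer code is obtained by sending the old codeword followed by \<open>l' - l\<close>
  zeros, which the receivers ignore. Padding keeps the encoder linear
  (\<open>linear_encoder_append_zero\<close>) and decoding correct
  (\<open>ppicod_code_append_zero\<close>). The decoding choice \<open>D\<close> is untouched, so
  the satisfaction metric stays \<open>s\<close>.\<close>

lemma linear_encoder_append_zero:
  assumes "linear_encoder m l E"
  shows "linear_encoder m (l + k) (\<lambda>X. E X @\<^sub>v 0\<^sub>v k)"
proof -
  obtain A where A: "A \<in> carrier_mat l m" "\<forall>X \<in> carrier_vec m. E X = A *\<^sub>v X"
    using assms unfolding linear_encoder_def by blast
  \<comment> \<open>Each padded zero is the product of a zero row with \<open>X\<close>, so the new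
    encoding matrix is \<open>A\<close> with \<open>k\<close> zero rows below it.\<close>
  have "A @\<^sub>r 0\<^sub>m k m \<in> carrier_mat (l + k) m"
    using A(1) by (simp add: carrier_append_rows)
  moreover have "E X @\<^sub>v 0\<^sub>v k = (A @\<^sub>r 0\<^sub>m k m) *\<^sub>v X" if "X \<in> carrier_vec m" for X
  proof -
    have "0\<^sub>m k m *\<^sub>v X = 0\<^sub>v k"
      using that by (intro eq_vecI) (auto simp: scalar_prod_def)
    then show ?thesis
      using A(2) that by (simp add: mat_mult_append[OF A(1) zero_carrier_mat that])
  qed
  ultimately show ?thesis
    unfolding linear_encoder_def by blast
qed

text \<open>Each receiver cuts the padding off and then runs its old decoder with the same side
  information.\<close>

lemma ppicod_code_append_zero:
  assumes "ppicod_code m n H l E D G"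
  shows "ppicod_code m n H (l + k) (\<lambda>X. E X @\<^sub>v 0\<^sub>v k) D (\<lambda>i (y, h). G i (vec_first y l, h))"
proof -
  have enc: "linear_encoder m l E"
    using assms unfolding ppicod_code_def by blast
  \<comment> \<open>Cutting at \<open>l\<close> recovers \<open>E X\<close> exactly because
    \<open>E X\<close> has dimension \<open>l\<close>; this comes from the matrix form of
    \<open>E\<close>, which is available only on \<open>carrier_vec m\<close>.\<close>
  then have "vec_first (E X @\<^sub>v 0\<^sub>v k) l = E X" if "X \<in> carrier_vec m" for X
    using that unfolding linear_encoder_def by (fastforce simp: vec_first_def)
  then show ?thesis
    using assms linear_encoder_append_zero[OF enc] unfolding ppicod_code_def by simp
qed

theorem proposition1:
  fixes m n l l' :: nat and H :: "nat \<Rightarrow> nat set" and P :: "ereal mat" and s :: ereal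
  assumes "ppicod_problem m n H P"
    and "achievable TYPE('a::{field,finite}) m n H P (l, s)"
    and "l' > l"
  shows "achievable TYPE('a) m n H P (l', s)"
proof -
  obtain E :: "'a vec \<Rightarrow> 'a vec" and D G
    where code: "ppicod_code m n H l E D G" and sat: "satisfaction n P D = s"
    using assms(2) unfolding achievable_def by auto
  \<comment> \<open>Subtraction on naturals truncates at 0; \<open>l' > l\<close> makes it exact
    here.\<close>
  have "l' = l + (l' - l)"
    using assms(3) by simp
  then show ?thesis
    using ppicod_code_append_zero[OF code, of "l' - l"] sat unfolding achievable_def by auto
qed

end
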